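(* If the weak KKT condition holds at $\widehat{x}\in S$, then $\widehat{x}$ is a weak efficient solution of $(P)$.
   Context: Setting: $p\geq 2$, $I:=\{1,\ldots,p\}$; $f_i:\mathbb{R}^n\to\mathbb{R}$ ($i\in I$) are finite-valued convex functions; $T$ is an infinite index set; for each $t\in T$, $g_t:\mathbb{R}^n\to\mathbb{R}\cup\{+\infty\}$ is a lower semicontinuous proper convex function. Problem $(P)$: minimize $f(x):=(f_1(x),\ldots,f_p(x))$ subject to $g_t(x)\le 0$, $t\in T$, with feasible set $S:=\{x\in\mathbb{R}^n\mid g_t(x)\le 0\ \forall t\in T\}$ assumed nonempty. $\widehat{x}\in S$ is a weak efficient solution of $(P)$ if there is no $x\in S$ with $f_i(x)<f_i(\widehat{x})$ for all $i\in I$. The weak KKT condition holds at $\widehat{x}\in S$ when there exist $\alpha_i\ge0$ ($i\in I$) with $\sum_{i=1}^p\alpha_i=1$, and $\beta_t\ge0$ ($t\in T(\widehat{x})$), with $\beta_t\neq0$ for finitely many indices only, such that $0_n\in\sum_{i=1}^p\alpha_i\partial f_i(\widehat{x})+\sum_{t\in T(\widehat{x})}\beta_t\partial g_t(\widehat{x})$. Here $\partial$ is the Fenchel–Moreau subdifferential and $T(\widehat{x}):=\{t\in T\mid g_t(\widehat{x})=0\}$. *)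

theory Defs
  imports "HOL-Analysis.Analysis"
begin

definition lsc :: "('a::topological_space \<Rightarrow> ereal) \<Rightarrow> bool" where
  "lsc h \<longleftrightarrow> (\<forall>x. h x \<le> Liminf (at x) h)"

definition proper_function :: "('a \<Rightarrow> ereal) \<Rightarrow> bool" where
  "proper_function h \<longleftrightarrow> (\<forall>x. h x \<noteq> -\<infinity>) \<and> (\<exists>x. h x \<noteq> \<infinity>)"

text \<open>Convexity of an extended-real-valued function means convexity of its epigraph,
  a subset of the product of the domain with the real line. (The library's \<open>convex_on\<close> and
  \<open>epigraph\<close> cover real-valued functions only.)\<close>

definition ereal_convex :: "('a::real_vector \<Rightarrow> ereal) \<Rightarrow> bool" where
  "ereal_convex h \<longleftrightarrow> convex {(x, r::real). h x \<le> ereal r}"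

text \<open>Fenchel--Moreau subdifferential, empty at points where \<open>h\<close> is not finite.\<close>

definition subdifferential :: "('a::real_inner \<Rightarrow> ereal) \<Rightarrow> 'a \<Rightarrow> 'a set" where
  "subdifferential h x =
     {u. \<bar>h x\<bar> \<noteq> \<infinity> \<and> (\<forall>y. h x + ereal (u \<bullet> (y - x)) \<le> h y)}"

definition feasible_set :: "'t set \<Rightarrow> ('t \<Rightarrow> 'a \<Rightarrow> ereal) \<Rightarrow> 'a set" where
  "feasible_set T g = {x. \<forall>t\<in>T. g t x \<le> 0}"

definition active_set :: "'t set \<Rightarrow> ('t \<Rightarrow> 'a \<Rightarrow> ereal) \<Rightarrow> 'a \<Rightarrow> 't set" where
  "active_set T g x = {t \<in> T. g t x = 0}"

definition weak_efficient ::
    "nat \<Rightarrow> (nat \<Rightarrow> 'a \<Rightarrow> real) \<Rightarrow> 't set \<Rightarrow> ('t \<Rightarrow> 'a \<Rightarrow> ereal) \<Rightarrow> 'a \<Rightarrow> bool" where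
  "weak_efficient p f T g xh \<longleftrightarrow>
     xh \<in> feasible_set T g \<and>
     \<not> (\<exists>x \<in> feasible_set T g. \<forall>i\<in>{1..p}. f i x < f i xh)"

text \<open>Sums of sets are Minkowski sums (\<open>HOL-Library.Set_Algebras\<close>); the empty sum is
  \<open>{0}\<close>. The sum over the active indices ranges over the finite support of \<open>\<beta>\<close>: indices with
  \<open>\<beta> t = 0\<close> contribute nothing, even if the subdifferential of \<open>g t\<close> is empty there.\<close>

definition weak_KKT ::
    "nat \<Rightarrow> (nat \<Rightarrow> 'a::real_inner \<Rightarrow> real) \<Rightarrow> 't set \<Rightarrow> ('t \<Rightarrow> 'a \<Rightarrow> ereal) \<Rightarrow> 'a \<Rightarrow> bool" where
  "weak_KKT p f T g xh \<longleftrightarrow>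
     (\<exists>\<alpha> \<beta>.
        (\<forall>i\<in>{1..p}. \<alpha> i \<ge> 0) \<and> (\<Sum>i\<in>{1..p}. \<alpha> i) = 1 \<and>
        (\<forall>t\<in>active_set T g xh. \<beta> t \<ge> 0) \<and>
        finite {t \<in> active_set T g xh. \<beta> t \<noteq> 0} \<and>
        0 \<in> (\<Sum>i\<in>{1..p}. (*\<^sub>R) (\<alpha> i) ` subdifferential (\<lambda>x. ereal (f i x)) xh)
          + (\<Sum>t\<in>{t \<in> active_set T g xh. \<beta> t \<noteq> 0}. (*\<^sub>R) (\<beta> t) ` subdifferential (g t) xh))"

end

theory Submission
  imports Defs
begin

text \<open>A subgradient at a point bounds from above its own slope in the direction of any other
  point, by the increase of the function. Suppose that some feasible \<open>x\<close> were strictly better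
  than \<open>xh\<close> in every objective, and put \<open>d = x - xh\<close>. Then every subgradient of an objective
  has negative inner product with \<open>d\<close>. A subgradient of an active constraint has nonpositive
  inner product with \<open>d\<close>, because the constraint increases from the value zero to a value that
  is still at most zero. In the weak KKT combination the multipliers are nonnegative and the
  \<open>\<alpha> i\<close> do not all vanish, so its inner product with \<open>d\<close> is negative. But the combination
  is the zero vector.\<close>

lemma scaled_set_sumE:
  fixes A :: "'i \<Rightarrow> 'a::real_vector set"
  assumes "finite I" and "w \<in> (\<Sum>i\<in>I. (*\<^sub>R) (c i) ` A i)"
  obtains a where "\<And>i. i \<in> I \<Longrightarrow> a i \<in> A i" and "w = (\<Sum>i\<in>I. c i *\<^sub>R a i)"
proof -
  from assms obtain s where s: "\<And>i. i \<in> I \<Longrightarrow> s i \<in> (*\<^sub>R) (c i) ` A i"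
    and w: "w = (\<Sum>i\<in>I. s i)"
    by (auto simp: set_sum_alt)
  from s have "\<forall>i\<in>I. \<exists>a. a \<in> A i \<and> s i = c i *\<^sub>R a" by blast
  then obtain a where "\<forall>i\<in>I. a i \<in> A i \<and> s i = c i *\<^sub>R a i"
    by (rule bchoice[THEN exE])
  with w show thesis by (intro that[of a]) auto
qed

lemma subgradient_real_bound:
  fixes f :: "'a::real_inner \<Rightarrow> real"
  assumes "u \<in> subdifferential (\<lambda>x. ereal (f x)) xh"
  shows "u \<bullet> (x - xh) \<le> f x - f xh"
proof -
  have "ereal (f xh) + ereal (u \<bullet> (x - xh)) \<le> ereal (f x)"
    using assms by (auto simp: subdifferential_def)
  then show ?thesis by simp
qed

lemma subgradient_active_nonpos:
  assumes "v \<in> subdifferential h xh" and "h xh = 0" and "h x \<le> 0"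
  shows "v \<bullet> (x - xh) \<le> 0"
proof -
  have "h xh + ereal (v \<bullet> (x - xh)) \<le> h x"
    using assms(1) by (auto simp: subdifferential_def)
  also note assms(3)
  finally show ?thesis by (simp add: assms(2))
qed

text \<open>Strictness survives because weights with sum one cannot all vanish.\<close>

lemma convex_combination_neg:
  fixes a c :: "'i \<Rightarrow> real"
  assumes "finite I" and "\<And>i. i \<in> I \<Longrightarrow> 0 \<le> a i" and "sum a I = 1"
    and "\<And>i. i \<in> I \<Longrightarrow> c i < 0"
  shows "(\<Sum>i\<in>I. a i * c i) < 0"
proof -
  obtain j where "j \<in> I" and "a j \<noteq> 0"
    using assms(3) by (metis sum.neutral zero_neq_one)
  with assms(2)[of j] assms(4)[of j] have "a j * c j < 0"
    by (simp add: mult_pos_neg)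
  moreover have "\<And>i. i \<in> I \<Longrightarrow> a i * c i \<le> 0"
    using assms(2,4) by (simp add: mult_nonneg_nonpos less_imp_le)
  ultimately show ?thesis
    using sum_strict_mono_ex1[of I "\<lambda>i. a i * c i" "\<lambda>_. 0"] assms(1) \<open>j \<in> I\<close> by auto
qed

theorem theorem3:
  fixes p :: nat
    and f :: "nat \<Rightarrow> real ^ 'n \<Rightarrow> real"
    and T :: "'t set"
    and g :: "'t \<Rightarrow> real ^ 'n \<Rightarrow> ereal"
    and xh :: "real ^ 'n"
  assumes "p \<ge> 2"
    and "\<And>i. i \<in> {1..p} \<Longrightarrow> convex_on UNIV (f i)"
    and "infinite T"
    and "\<And>t. t \<in> T \<Longrightarrow> lsc (g t)"
    and "\<And>t. t \<in> T \<Longrightarrow> proper_function (g t)"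
    and "\<And>t. t \<in> T \<Longrightarrow> ereal_convex (g t)"
    and "feasible_set T g \<noteq> {}"
    and "xh \<in> feasible_set T g"
    and "weak_KKT p f T g xh"
  shows "weak_efficient p f T g xh"
proof -
  let ?A = "\<lambda>\<beta>::'t \<Rightarrow> real. {t \<in> active_set T g xh. \<beta> t \<noteq> 0}"
  from assms(9) obtain \<alpha> \<beta> where
    \<alpha>: "\<And>i. i \<in> {1..p} \<Longrightarrow> 0 \<le> \<alpha> i" "sum \<alpha> {1..p} = 1"
    and \<beta>: "\<And>t. t \<in> active_set T g xh \<Longrightarrow> 0 \<le> \<beta> t" "finite (?A \<beta>)"
    and zero: "0 \<in> (\<Sum>i\<in>{1..p}. (*\<^sub>R) (\<alpha> i) ` subdifferential (\<lambda>x. ereal (f i x)) xh)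
      + (\<Sum>t\<in>?A \<beta>. (*\<^sub>R) (\<beta> t) ` subdifferential (g t) xh)"
    unfolding weak_KKT_def by blast
  from zero obtain w z where
    w: "w \<in> (\<Sum>i\<in>{1..p}. (*\<^sub>R) (\<alpha> i) ` subdifferential (\<lambda>x. ereal (f i x)) xh)"
    and z: "z \<in> (\<Sum>t\<in>?A \<beta>. (*\<^sub>R) (\<beta> t) ` subdifferential (g t) xh)"
    and wz: "0 = w + z"
    by (rule set_plus_elim)
  obtain u where u: "\<And>i. i \<in> {1..p} \<Longrightarrow> u i \<in> subdifferential (\<lambda>x. ereal (f i x)) xh"
    and w_eq: "w = (\<Sum>i\<in>{1..p}. \<alpha> i *\<^sub>R u i)"
    by (rule scaled_set_sumE[OF finite_atLeastAtMost w]) (rule that)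
  obtain v where v: "\<And>t. t \<in> ?A \<beta> \<Longrightarrow> v t \<in> subdifferential (g t) xh"
    and z_eq: "z = (\<Sum>t\<in>?A \<beta>. \<beta> t *\<^sub>R v t)"
    by (rule scaled_set_sumE[OF \<beta>(2) z]) (rule that)
  have False if x: "x \<in> feasible_set T g" and better: "\<forall>i\<in>{1..p}. f i x < f i xh" for x
  proof -
    have "u i \<bullet> (x - xh) < 0" if "i \<in> {1..p}" for i
      using subgradient_real_bound[OF u[OF that], of x] better that by fastforce
    then have "(\<Sum>i\<in>{1..p}. \<alpha> i * (u i \<bullet> (x - xh))) < 0"
      using \<alpha> by (intro convex_combination_neg) auto
    then have w_neg: "w \<bullet> (x - xh) < 0"
      by (simp add: w_eq inner_sum_left)
    have "\<beta> t * (v t \<bullet> (x - xh)) \<le> 0" if t: "t \<in> ?A \<beta>" for t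
    proof -
      have "g t xh = 0" "g t x \<le> 0"
        using t x by (auto simp: active_set_def feasible_set_def)
      with v[OF t] have "v t \<bullet> (x - xh) \<le> 0"
        by (rule subgradient_active_nonpos)
      with \<beta>(1) t show ?thesis by (simp add: mult_nonneg_nonpos)
    qed
    then have "z \<bullet> (x - xh) \<le> 0"
      unfolding z_eq inner_sum_left inner_scaleR_left by (rule sum_nonpos)
    with w_neg have "(w + z) \<bullet> (x - xh) < 0"
      by (simp add: inner_add_left)
    with wz show False by (metis inner_zero_left less_irrefl)
  qed
  with assms(8) show ?thesis
    unfolding weak_efficient_def by blast
qed

end
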